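(* Let $k\ge 2$ be an integer and let $G$ be a $\{C_3,C_5,C_{2k},C_{2k+2}\}$-free graph with maximum degree $\Delta$. Then $\omega_2'(G)\le \max\{k\Delta,\,2k(k-1)\}$.
   Context: Graphs are finite and simple. $C_m$ denotes the cycle with $m$ vertices; a graph is $\mathcal F$-free, for a set $\mathcal F$ of graphs, if it contains no member of $\mathcal F$ as a (not necessarily induced) subgraph. A strong clique of $G$ is a set of edges of $G$ such that any two distinct edges in the set either share an endpoint or are connected by an edge of $G$ (i.e. some edge of $G$ joins an endpoint of one to an endpoint of the other). The strong clique number $\omega_2'(G)$ is the size of a largest strong clique of $G$. *)

theory Defs
  imports Main
begin

type_synonym 'a graph = "'a set \<times> 'a set set"

abbreviation verts :: "'a graph \<Rightarrow> 'a set" where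
  "verts G \<equiv> fst G"

abbreviation edges :: "'a graph \<Rightarrow> 'a set set" where
  "edges G \<equiv> snd G"

definition simple_graph :: "'a graph \<Rightarrow> bool" where
  "simple_graph G \<longleftrightarrow>
     finite (verts G) \<and> (\<forall>e\<in>edges G. e \<subseteq> verts G \<and> card e = 2)"

definition degree :: "'a graph \<Rightarrow> 'a \<Rightarrow> nat" where
  "degree G v = card {e \<in> edges G. v \<in> e}"

text \<open>The inserted \<open>0\<close> only matters for the graph without vertices.\<close>

definition max_degree :: "'a graph \<Rightarrow> nat" where
  "max_degree G = Max (insert 0 (degree G ` verts G))"

text \<open>The cycle with \<open>m\<close> vertices, meaningful for \<open>m \<ge> 3\<close>.\<close>

definition cycle_graph :: "nat \<Rightarrow> nat graph" where
  "cycle_graph m = ({..<m}, {{i, Suc i mod m} | i. i < m})"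

definition contains_subgraph :: "'a graph \<Rightarrow> 'b graph \<Rightarrow> bool" where
  "contains_subgraph G H \<longleftrightarrow>
     (\<exists>f. inj_on f (verts H) \<and> f ` verts H \<subseteq> verts G \<and> (\<forall>e\<in>edges H. f ` e \<in> edges G))"

definition graph_free :: "'b graph set \<Rightarrow> 'a graph \<Rightarrow> bool" where
  "graph_free \<F> G \<longleftrightarrow> (\<forall>H\<in>\<F>. \<not> contains_subgraph G H)"

definition strong_clique :: "'a graph \<Rightarrow> 'a set set \<Rightarrow> bool" where
  "strong_clique G S \<longleftrightarrow> S \<subseteq> edges G \<and>
     (\<forall>e\<in>S. \<forall>f\<in>S. e \<noteq> f \<longrightarrow>
        e \<inter> f \<noteq> {} \<or> (\<exists>x\<in>e. \<exists>y\<in>f. {x, y} \<in> edges G))"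

definition strong_clique_number :: "'a graph \<Rightarrow> nat" where
  "strong_clique_number G = Max {card S | S. strong_clique G S}"

lemma simple_graph_cycle_graph:
  assumes "m \<ge> 3"
  shows "simple_graph (cycle_graph m)"
proof -
  have "i \<noteq> Suc i mod m" if "i < m" for i
    using that assms by (cases "Suc i = m") auto
  then show ?thesis
    using assms by (auto simp: simple_graph_def cycle_graph_def)
qed

lemma finite_strong_clique_cards:
  assumes "simple_graph G"
  shows "finite {card S | S. strong_clique G S}" "{card S | S. strong_clique G S} \<noteq> {}"
proof -
  have "edges G \<subseteq> Pow (verts G)" "finite (verts G)"
    using assms by (auto simp: simple_graph_def)
  then have "finite (Pow (edges G))"
    by (meson finite_Pow_iff finite_subset)
  moreover have "{S. strong_clique G S} \<subseteq> Pow (edges G)"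
    by (auto simp: strong_clique_def)
  ultimately have "finite {S. strong_clique G S}"
    by (rule rev_finite_subset)
  then show "finite {card S | S. strong_clique G S}"
    by simp
  have "strong_clique G {}"
    by (simp add: strong_clique_def)
  then show "{card S | S. strong_clique G S} \<noteq> {}"
    by blast
qed

end

theory Submission
  imports Defs
begin

text \<open>
  Fix an edge \<open>ab\<close> of a strong clique \<open>S\<close>. Every edge of \<open>S\<close> joins an end \<open>x\<close> of a walk of length 2
  from \<open>a\<close> to an end \<open>y\<close> of a walk of length 2 from \<open>b\<close>. As there are no closed walks of length 5,
  the \<open>x\<close> and the \<open>y\<close> form two disjoint independent sets, so any two edges \<open>xy\<close>, \<open>x'y'\<close> of \<open>S\<close>
  satisfy \<open>x \<sim> y'\<close> or \<open>x' \<sim> y\<close>. A matching of \<open>k + 1\<close> edges of \<open>S\<close> is therefore a semicomplete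
  digraph, so it has a Hamiltonian path \<open>x\<^sub>0y\<^sub>0, \<dots>, x\<^sub>ky\<^sub>k\<close> with \<open>x\<^sub>i \<sim> y\<^sub>i\<^sub>+\<^sub>1\<close>. If \<open>x\<^sub>0 \<sim> y\<^sub>k\<close> this
  closes up to a \<open>C\<^sub>2\<^sub>k\<close>, and if \<open>x\<^sub>k \<sim> y\<^sub>0\<close> to a \<open>C\<^sub>2\<^sub>k\<^sub>+\<^sub>2\<close>. Hence there is no such matching, and by
  Koenig's theorem \<open>k\<close> vertices cover all edges of \<open>S\<close>, which gives at most \<open>k\<Delta>\<close> edges.
\<close>

section \<open>Koenig's theorem\<close>

definition matching :: "('a \<times> 'b) set \<Rightarrow> bool" where
  "matching M \<longleftrightarrow> inj_on fst M \<and> inj_on snd M"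

definition vertex_cover :: "'a set \<Rightarrow> 'b set \<Rightarrow> ('a \<times> 'b) set \<Rightarrow> bool" where
  "vertex_cover C D R \<longleftrightarrow> finite C \<and> finite D \<and> (\<forall>(x, y)\<in>R. x \<in> C \<or> y \<in> D)"

definition cover_number :: "('a \<times> 'b) set \<Rightarrow> nat" where
  "cover_number R = (LEAST n. \<exists>C D. vertex_cover C D R \<and> card C + card D = n)"

lemma matching_subset: "matching M \<Longrightarrow> N \<subseteq> M \<Longrightarrow> matching N"
  unfolding matching_def by (blast intro: inj_on_subset)

lemma cover_number_le: "vertex_cover C D R \<Longrightarrow> cover_number R \<le> card C + card D"
  unfolding cover_number_def by (blast intro: Least_le)

lemma minimum_vertex_cover:
  assumes "finite R"
  obtains C D where "vertex_cover C D R" "card C + card D = cover_number R"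
proof -
  have "vertex_cover (fst ` R) {} R"
    using assms by (force simp: vertex_cover_def)
  then have "\<exists>n C D. vertex_cover C D R \<and> card C + card D = n"
    by blast
  from LeastI_ex[OF this] show thesis
    using that unfolding cover_number_def by blast
qed

lemma cover_number_mono:
  assumes "R \<subseteq> R'" "finite R'"
  shows "cover_number R \<le> cover_number R'"
proof -
  obtain C D where "vertex_cover C D R'" "card C + card D = cover_number R'"
    using assms(2) by (rule minimum_vertex_cover)
  moreover from this have "vertex_cover C D R"
    using assms(1) by (auto simp: vertex_cover_def)
  ultimately show ?thesis
    by (metis cover_number_le)
qed

lemma cover_number_converse: "cover_number (R\<inverse>) = cover_number R"
proof -
  have "vertex_cover D C (R\<inverse>) \<longleftrightarrow> vertex_cover C D R" for C D
    by (auto simp: vertex_cover_def)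
  then have "(\<exists>C D. vertex_cover C D (R\<inverse>) \<and> card C + card D = n) \<longleftrightarrow>
      (\<exists>C D. vertex_cover C D R \<and> card C + card D = n)" for n
    by (metis add.commute)
  then show ?thesis
    by (simp add: cover_number_def)
qed

lemma card_matching_le_vertex_cover:
  assumes "matching M" "vertex_cover C D M"
  shows "card M \<le> card C + card D"
proof -
  let ?MC = "{e \<in> M. fst e \<in> C}" and ?MD = "{e \<in> M. snd e \<in> D}"
  have inj: "inj_on fst ?MC" "inj_on snd ?MD"
    using assms(1) unfolding matching_def by (auto intro: inj_on_subset)
  have fin: "finite C" "finite D"
    using assms(2) by (auto simp: vertex_cover_def)
  have "M = ?MC \<union> ?MD"
    using assms(2) by (auto simp: vertex_cover_def)
  then have "card M = card (?MC \<union> ?MD)"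
    by (rule arg_cong)
  also have "\<dots> \<le> card ?MC + card ?MD"
    by (rule card_Un_le)
  also have "\<dots> \<le> card C + card D"
    using inj fin by (intro add_mono card_inj_on_le) auto
  finally show ?thesis .
qed

lemma fst_notin_smaller_vertex_cover:
  assumes "vertex_cover C D (R - {(x, y)})" "card C + card D < cover_number R"
  shows "x \<notin> C"
proof -
  have "\<not> vertex_cover C D R"
    using assms(2) cover_number_le by (meson not_le)
  then show ?thesis
    using assms(1) by (auto simp: vertex_cover_def)
qed

lemma cover_number_uncross:
  assumes edges: "(x, y\<^sub>1) \<in> R" "(x, y\<^sub>2) \<in> R" "y\<^sub>1 \<noteq> y\<^sub>2"
    and cover\<^sub>1: "vertex_cover C\<^sub>1 D\<^sub>1 (R - {(x, y\<^sub>1)})" "x \<notin> C\<^sub>1"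
    and cover\<^sub>2: "vertex_cover C\<^sub>2 D\<^sub>2 (R - {(x, y\<^sub>2)})" "x \<notin> C\<^sub>2"
  shows "2 * cover_number R \<le> Suc (card C\<^sub>1 + card D\<^sub>1 + (card C\<^sub>2 + card D\<^sub>2))"
proof -
  have fin: "finite C\<^sub>1" "finite D\<^sub>1" "finite C\<^sub>2" "finite D\<^sub>2"
    using cover\<^sub>1(1) cover\<^sub>2(1) by (auto simp: vertex_cover_def)
  have "y\<^sub>2 \<in> D\<^sub>1" "y\<^sub>1 \<in> D\<^sub>2"
    using edges cover\<^sub>1 cover\<^sub>2 by (auto simp: vertex_cover_def)
  then have "vertex_cover (C\<^sub>1 \<inter> C\<^sub>2) (D\<^sub>1 \<union> D\<^sub>2) R"
    using cover\<^sub>1(1) cover\<^sub>2(1) unfolding vertex_cover_def by fastforce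
  then have "cover_number R \<le> card (C\<^sub>1 \<inter> C\<^sub>2) + card (D\<^sub>1 \<union> D\<^sub>2)"
    by (rule cover_number_le)
  moreover have "vertex_cover (insert x (C\<^sub>1 \<union> C\<^sub>2)) (D\<^sub>1 \<inter> D\<^sub>2) R"
    using cover\<^sub>1(1) cover\<^sub>2(1) unfolding vertex_cover_def by fastforce
  then have "cover_number R \<le> card (insert x (C\<^sub>1 \<union> C\<^sub>2)) + card (D\<^sub>1 \<inter> D\<^sub>2)"
    by (rule cover_number_le)
  moreover have "card (insert x (C\<^sub>1 \<union> C\<^sub>2)) \<le> Suc (card (C\<^sub>1 \<union> C\<^sub>2))"
    using fin by (simp add: card_insert_if)
  ultimately show ?thesis
    using card_Un_Int[of C\<^sub>1 C\<^sub>2] card_Un_Int[of D\<^sub>1 D\<^sub>2] fin by linarith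
qed

lemma inj_on_fst_if_cover_critical:
  assumes "finite R"
    and critical: "\<And>e. e \<in> R \<Longrightarrow> cover_number (R - {e}) < cover_number R"
  shows "inj_on fst R"
proof (rule inj_onI, rule ccontr)
  fix e\<^sub>1 e\<^sub>2 assume "e\<^sub>1 \<in> R" "e\<^sub>2 \<in> R" "fst e\<^sub>1 = fst e\<^sub>2" "e\<^sub>1 \<noteq> e\<^sub>2"
  then obtain x y\<^sub>1 y\<^sub>2 where edges: "(x, y\<^sub>1) \<in> R" "(x, y\<^sub>2) \<in> R" "y\<^sub>1 \<noteq> y\<^sub>2"
    by (metis prod.collapse)
  have smaller_cover: "\<exists>C D. vertex_cover C D (R - {e}) \<and> card C + card D < cover_number R"
    if "e \<in> R" for e
    using critical[OF that] minimum_vertex_cover[of "R - {e}"] \<open>finite R\<close> by (metis finite_Diff)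
  obtain C\<^sub>1 D\<^sub>1 where cover\<^sub>1: "vertex_cover C\<^sub>1 D\<^sub>1 (R - {(x, y\<^sub>1)})"
    and smaller\<^sub>1: "card C\<^sub>1 + card D\<^sub>1 < cover_number R"
    using smaller_cover edges(1) by blast
  obtain C\<^sub>2 D\<^sub>2 where cover\<^sub>2: "vertex_cover C\<^sub>2 D\<^sub>2 (R - {(x, y\<^sub>2)})"
    and smaller\<^sub>2: "card C\<^sub>2 + card D\<^sub>2 < cover_number R"
    using smaller_cover edges(2) by blast
  have "x \<notin> C\<^sub>1" "x \<notin> C\<^sub>2"
    using cover\<^sub>1 smaller\<^sub>1 cover\<^sub>2 smaller\<^sub>2 by (auto dest: fst_notin_smaller_vertex_cover)
  then have "2 * cover_number R \<le> Suc (card C\<^sub>1 + card D\<^sub>1 + (card C\<^sub>2 + card D\<^sub>2))"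
    using edges cover\<^sub>1 cover\<^sub>2 by (intro cover_number_uncross)
  then show False
    using smaller\<^sub>1 smaller\<^sub>2 by linarith
qed

lemma matching_if_cover_critical:
  assumes "finite R"
    and critical: "\<And>e. e \<in> R \<Longrightarrow> cover_number (R - {e}) < cover_number R"
  shows "matching R"
proof -
  have "inj_on fst R"
    using assms by (rule inj_on_fst_if_cover_critical)
  moreover have "inj_on fst (R\<inverse>)"
  proof (rule inj_on_fst_if_cover_critical)
    fix e assume "e \<in> R\<inverse>"
    then have "cover_number (R - {prod.swap e}) < cover_number R"
      by (intro critical) auto
    moreover have "(R - {prod.swap e})\<inverse> = R\<inverse> - {e}"
      by (cases e) auto
    ultimately show "cover_number (R\<inverse> - {e}) < cover_number (R\<inverse>)"
      by (metis cover_number_converse)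
  qed (use \<open>finite R\<close> in simp)
  then have "inj_on snd R"
    by (fastforce simp: inj_on_def Ball_def)
  ultimately show ?thesis
    by (simp add: matching_def)
qed

theorem Koenig:
  assumes "finite R"
  shows "\<exists>M\<subseteq>R. matching M \<and> card M = cover_number R"
  using assms
proof (induction rule: finite_psubset_induct)
  case (psubset R)
  show ?case
  proof (cases "\<exists>e\<in>R. cover_number R \<le> cover_number (R - {e})")
    case True
    then obtain e where "e \<in> R" "cover_number R \<le> cover_number (R - {e})"
      by blast
    then have "cover_number (R - {e}) = cover_number R" "R - {e} \<subset> R"
      using cover_number_mono[of "R - {e}" R] psubset.hyps by auto
    then show ?thesis
      using psubset.IH[of "R - {e}"] by auto
  next
    case False
    then have "matching R"
      using psubset.hyps by (intro matching_if_cover_critical) auto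
    moreover obtain C D where "vertex_cover C D R" "card C + card D = cover_number R"
      using psubset.hyps by (rule minimum_vertex_cover)
    then have "card R \<le> cover_number R"
      using card_matching_le_vertex_cover[OF \<open>matching R\<close>] by metis
    moreover have "vertex_cover (fst ` R) {} R"
      using psubset.hyps by (force simp: vertex_cover_def)
    then have "cover_number R \<le> card R"
      using cover_number_le card_image_le[OF psubset.hyps, of fst] by fastforce
    ultimately show ?thesis
      by auto
  qed
qed

section \<open>Hamiltonian paths in semicomplete digraphs\<close>

lemma totalp_on_Hamiltonian_path:
  assumes "finite M" "totalp_on M P"
  shows "\<exists>xs. distinct xs \<and> set xs = M \<and> successively P xs"
  using assms
proof (induction rule: finite_induct)
  case empty
  then show ?case by simp
next
  case (insert v M)
  then obtain xs where path: "distinct xs" "set xs = M" "successively P xs"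
    by (auto simp: totalp_on_def)
  define ys zs where "ys = takeWhile (\<lambda>u. P u v) xs" and "zs = dropWhile (\<lambda>u. P u v) xs"
  have split: "xs = ys @ zs"
    by (simp add: ys_def zs_def)
  have to_v: "P (last ys) v" if "ys \<noteq> []"
    using that last_in_set set_takeWhileD unfolding ys_def by metis
  have from_v: "P v (hd zs)" if "zs \<noteq> []"
  proof -
    have "\<not> P (hd zs) v"
      using that unfolding zs_def by (rule hd_dropWhile)
    moreover have "hd zs \<in> M"
      using that split path(2) by auto
    ultimately show ?thesis
      using insert.prems insert.hyps(2) by (metis insertCI totalp_onD)
  qed
  have "successively P (ys @ v # zs)"
    using path(3) to_v from_v by (auto simp: split successively_append_iff successively_Cons)
  moreover have "distinct (ys @ v # zs)" "set (ys @ v # zs) = insert v M"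
    using path(1,2) insert.hyps(2) by (auto simp: split)
  ultimately show ?case
    by blast
qed

section \<open>Cycles and closed walks\<close>

definition adj :: "'a graph \<Rightarrow> 'a \<Rightarrow> 'a \<Rightarrow> bool" where
  "adj G x y \<longleftrightarrow> {x, y} \<in> edges G"

lemma adj_commute: "adj G x y \<longleftrightarrow> adj G y x"
  by (simp add: adj_def insert_commute)

lemma adj_irrefl: "simple_graph G \<Longrightarrow> \<not> adj G x x"
  by (auto simp: simple_graph_def adj_def)

lemma adj_in_verts: "simple_graph G \<Longrightarrow> adj G x y \<Longrightarrow> x \<in> verts G \<and> y \<in> verts G"
  by (auto simp: simple_graph_def adj_def)

lemma symp_relpowp:
  assumes "symp P"
  shows "symp (P ^^ n)"
proof (induction n)
  case 0
  show ?case by (simp add: sympI)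
next
  case (Suc n)
  show ?case
  proof (rule sympI)
    fix x z assume "(P ^^ Suc n) x z"
    then obtain y where "(P ^^ n) x y" "P y z"
      by (rule relpowp_Suc_E)
    then have "P z y" "(P ^^ n) y x"
      using assms Suc by (auto dest: sympD)
    then show "(P ^^ Suc n) z x"
      by (rule relpowp_Suc_I2)
  qed
qed

lemma relpowp_adj_commute: "(adj G ^^ n) x y \<longleftrightarrow> (adj G ^^ n) y x"
proof -
  have "symp (adj G)"
    by (simp add: symp_def adj_commute)
  then have "symp (adj G ^^ n)"
    by (rule symp_relpowp)
  then show ?thesis
    by (blast dest: sympD)
qed

lemma contains_cycle_graphI:
  assumes "simple_graph G" "distinct xs" "successively (adj G) xs" "adj G (last xs) (hd xs)"
  shows "contains_subgraph G (cycle_graph (length xs))"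
proof -
  have step: "adj G (xs ! i) (xs ! (Suc i mod length xs))" if "i < length xs" for i
  proof (cases "Suc i = length xs")
    case True
    moreover from this have "xs \<noteq> []" "i = length xs - 1"
      by auto
    ultimately show ?thesis
      using assms(4) by (simp add: last_conv_nth hd_conv_nth)
  next
    case False
    then show ?thesis
      using assms(3) that by (simp add: successively_conv_nth)
  qed
  moreover have "xs ! i \<in> verts G" if "i < length xs" for i
    using adj_in_verts[OF assms(1) step[OF that]] by simp
  moreover have "inj_on ((!) xs) {..<length xs}"
    using assms(2) by (intro inj_on_nth) auto
  ultimately show ?thesis
    unfolding contains_subgraph_def cycle_graph_def adj_def by (intro exI[of _ "(!) xs"]) auto
qed

lemma closed_walk_inj_contains_cycle:
  assumes "simple_graph G" "n > 0" "inj_on f {..<n}" "f n = f 0"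
    and walk: "\<And>i. i < n \<Longrightarrow> adj G (f i) (f (Suc i))"
  shows "contains_subgraph G (cycle_graph n)"
proof -
  obtain n' where n: "n = Suc n'"
    using assms(2) by (cases n) auto
  have path: "successively (adj G) (map f [0..<n])"
    using walk by (auto simp: successively_conv_nth)
  have distinct: "distinct (map f [0..<n])"
    using assms(3) by (simp add: distinct_map atLeast0LessThan)
  have "last (map f [0..<n]) = f n'"
    by (simp add: n)
  moreover have "hd (map f [0..<n]) = f n"
    using assms(4) by (simp add: n upt_conv_Cons del: upt_Suc)
  ultimately have "adj G (last (map f [0..<n])) (hd (map f [0..<n]))"
    using walk[of n'] by (simp add: n)
  then show ?thesis
    using contains_cycle_graphI[OF assms(1) distinct path] by simp
qed

lemma closed_odd_walk_shorten:
  assumes walk: "\<And>i. i < n \<Longrightarrow> P (f i) (f (Suc i))"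
    and "f n = f 0" "odd n" "\<not> inj_on f {..<n}"
  shows "\<exists>m<n. odd m \<and> (\<exists>x. (P ^^ m) x x)"
proof -
  obtain i j where repeat: "i < j" "j < n" "f i = f j"
    using assms(4) linorder_inj_onI'[of "{..<n}" f] by auto
  have subwalk: "(P ^^ (q - p)) (f p) (f q)" if "p \<le> q" "q \<le> n" for p q
    unfolding relpowp_fun_conv using that walk by (intro exI[of _ "\<lambda>l. f (p + l)"]) auto
  have inner: "(P ^^ (j - i)) (f i) (f i)"
    using subwalk[of i j] repeat by simp
  have "(P ^^ i) (f 0) (f i)" "(P ^^ (n - j)) (f i) (f 0)"
    using subwalk[of 0 i] subwalk[of j n] repeat assms(2) by simp_all
  then have outer: "(P ^^ (i + (n - j))) (f 0) (f 0)"
    by (rule relpowp_trans)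
  have "odd (j - i) \<or> odd (i + (n - j))"
    using assms(3) repeat(1,2) by presburger
  moreover have "j - i < n" "i + (n - j) < n"
    using repeat(1,2) by auto
  ultimately show ?thesis
    using inner outer by blast
qed

lemma closed_odd_walk_contains_odd_cycle:
  assumes "simple_graph G" "(adj G ^^ n) x x" "odd n"
  shows "\<exists>m. odd m \<and> 3 \<le> m \<and> m \<le> n \<and> contains_subgraph G (cycle_graph m)"
  using assms(2,3)
proof (induction n arbitrary: x rule: less_induct)
  case (less n)
  obtain f where closed: "f 0 = x" "f n = x"
    and walk: "\<And>i. i < n \<Longrightarrow> adj G (f i) (f (Suc i))"
    using less.prems(1) unfolding relpowp_fun_conv by blast
  show ?case
  proof (cases "inj_on f {..<n}")
    case True
    have "n > 0"
      using less.prems(2) by (rule odd_pos)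
    then have "contains_subgraph G (cycle_graph n)"
      using True closed walk by (intro closed_walk_inj_contains_cycle[of G n f] assms(1)) auto
    moreover have "n \<noteq> 1"
      using closed walk[of 0] adj_irrefl[OF assms(1)] by auto
    then have "3 \<le> n"
      using less.prems(2) by presburger
    ultimately show ?thesis
      using less.prems(2) by blast
  next
    case False
    then obtain l y where "l < n" "odd l" "(adj G ^^ l) y y"
      using closed_odd_walk_shorten[of n "adj G" f] walk closed less.prems(2) by auto
    then obtain m where "odd m" "3 \<le> m" "m \<le> l" "contains_subgraph G (cycle_graph m)"
      using less.IH by blast
    then show ?thesis
      using \<open>l < n\<close> by (meson le_trans less_imp_le)
  qed
qed

section \<open>Splitting a strong clique\<close>

definition independent_set :: "'a graph \<Rightarrow> 'a set \<Rightarrow> bool" where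
  "independent_set G X \<longleftrightarrow> (\<forall>x\<in>X. \<forall>y\<in>X. \<not> adj G x y)"

lemma closed_walk_through_edge:
  assumes "(adj G ^^ n) a x" "adj G x y" "(adj G ^^ n) a y"
  shows "(adj G ^^ (2 * n + 1)) a a"
proof -
  have "(adj G ^^ Suc n) a y"
    using assms(1,2) by (rule relpowp_Suc_I)
  moreover have "(adj G ^^ n) y a"
    using assms(3) by (simp add: relpowp_adj_commute)
  ultimately have "(adj G ^^ (Suc n + n)) a a"
    by (rule relpowp_trans)
  then show ?thesis
    by (simp add: mult_2)
qed

lemma independent_set_walk_ends:
  assumes "\<not> (adj G ^^ (2 * n + 1)) a a"
  shows "independent_set G {x. (adj G ^^ n) a x}"
  unfolding independent_set_def
proof (intro ballI notI)
  fix x y assume "x \<in> {x. (adj G ^^ n) a x}" "y \<in> {x. (adj G ^^ n) a x}" "adj G x y"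
  then have "(adj G ^^ (2 * n + 1)) a a"
    by (intro closed_walk_through_edge[of n G a x y]) auto
  with assms show False
    by contradiction
qed

lemma disjoint_walk_ends:
  assumes "adj G a b" "\<And>x. \<not> (adj G ^^ (2 * n + 1)) x x"
  shows "{x. (adj G ^^ n) a x} \<inter> {x. (adj G ^^ n) b x} = {}"
proof (rule equals0I)
  fix x assume "x \<in> {x. (adj G ^^ n) a x} \<inter> {x. (adj G ^^ n) b x}"
  then have "(adj G ^^ n) x a" "(adj G ^^ n) x b"
    by (simp_all add: relpowp_adj_commute[of n G x])
  then have "(adj G ^^ (2 * n + 1)) x x"
    using assms(1) by (intro closed_walk_through_edge)
  with assms(2) show False
    by contradiction
qed

lemma strong_clique_imp_adj: "strong_clique G S \<Longrightarrow> {x, y} \<in> S \<Longrightarrow> adj G x y"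
  by (auto simp: strong_clique_def adj_def)

lemma strong_clique_edgeE:
  assumes "simple_graph G" "strong_clique G S" "e \<in> S"
  obtains x y where "e = {x, y}" "adj G x y"
proof -
  have "card e = 2"
    using assms by (auto simp: strong_clique_def simple_graph_def)
  then obtain x y where e: "e = {x, y}"
    by (auto simp: card_2_iff)
  then have "adj G x y"
    using assms(2,3) strong_clique_imp_adj[of G S] by simp
  with e show thesis
    by (rule that)
qed

lemma strong_clique_ends_adj:
  assumes "strong_clique G S" "{x, y} \<in> S" "{x', y'} \<in> S"
  shows "adj G x x' \<or> adj G x y' \<or> adj G y x' \<or> adj G y y'"
proof (cases "{x, y} \<inter> {x', y'} = {}")
  case True
  then show ?thesis
    using assms unfolding strong_clique_def adj_def by blast
next
  case False
  moreover have "adj G x y" "adj G x' y'"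
    using assms by (auto intro: strong_clique_imp_adj)
  ultimately show ?thesis
    by (auto simp: adj_commute)
qed

lemma strong_clique_edge_between_walk_ends:
  assumes "simple_graph G" "strong_clique G S" "{a, b} \<in> S" "e \<in> S"
  shows "\<exists>x y. e = {x, y} \<and> (adj G ^^ 2) a x \<and> (adj G ^^ 2) b y"
proof -
  have ab: "adj G a b"
    using assms(2,3) by (rule strong_clique_imp_adj)
  obtain u v where e: "e = {u, v}" and uv: "adj G u v"
    using assms(1,2,4) by (rule strong_clique_edgeE)
  have two_walk: "(adj G ^^ 2) x z" if "adj G x y" "adj G y z" for x y z
    using that by (auto simp: numeral_2_eq_2)
  have "adj G u a \<or> adj G u b \<or> adj G v a \<or> adj G v b"
    using strong_clique_ends_adj[OF assms(2)] assms(3,4) e by blast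
  then consider (u_left) "adj G u b \<or> adj G v a" | (v_left) "adj G v b \<or> adj G u a"
    by blast
  then show ?thesis
  proof cases
    case u_left
    then have "(adj G ^^ 2) a u" "(adj G ^^ 2) b v"
      using ab uv two_walk by (meson adj_commute)+
    then show ?thesis
      using e by blast
  next
    case v_left
    then have "(adj G ^^ 2) a v" "(adj G ^^ 2) b u"
      using ab uv two_walk by (meson adj_commute)+
    then show ?thesis
      using e by (auto simp: insert_commute)
  qed
qed

lemma strong_clique_bipartition:
  assumes "simple_graph G" "strong_clique G S"
    and no_closed_5_walk: "\<And>x. \<not> (adj G ^^ 5) x x"
  obtains X Y where "independent_set G X" "independent_set G Y" "X \<inter> Y = {}"
    "\<And>e. e \<in> S \<Longrightarrow> \<exists>x\<in>X. \<exists>y\<in>Y. e = {x, y}"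
proof (cases "S = {}")
  case True
  then show ?thesis
    by (intro that[of "{}" "{}"]) (auto simp: independent_set_def)
next
  case False
  then obtain a b where ab: "{a, b} \<in> S" "adj G a b"
    using strong_clique_edgeE[OF assms(1,2)] by (metis ex_in_conv)
  let ?X = "{x. (adj G ^^ 2) a x}" and ?Y = "{y. (adj G ^^ 2) b y}"
  show ?thesis
  proof (rule that)
    show "independent_set G ?X" "independent_set G ?Y"
      using no_closed_5_walk by (auto intro!: independent_set_walk_ends)
    show "?X \<inter> ?Y = {}"
      using ab(2) no_closed_5_walk by (intro disjoint_walk_ends) auto
    show "\<exists>x\<in>?X. \<exists>y\<in>?Y. e = {x, y}" if "e \<in> S" for e
      using strong_clique_edge_between_walk_ends[OF assms(1,2) ab(1) that] by blast
  qed
qed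

section \<open>Cycles through matched edges\<close>

definition cross_adj :: "'a graph \<Rightarrow> 'a \<times> 'a \<Rightarrow> 'a \<times> 'a \<Rightarrow> bool" where
  "cross_adj G e f \<longleftrightarrow> adj G (fst e) (snd f)"

definition edges_between :: "'a set \<Rightarrow> 'a set \<Rightarrow> 'a set set \<Rightarrow> ('a \<times> 'a) set" where
  "edges_between X Y S = {e \<in> X \<times> Y. {fst e, snd e} \<in> S}"

lemma finite_edges_between:
  assumes "simple_graph G" "S \<subseteq> edges G"
  shows "finite (edges_between X Y S)"
proof (rule finite_subset)
  show "edges_between X Y S \<subseteq> verts G \<times> verts G"
    using assms unfolding edges_between_def simple_graph_def by fastforce
  show "finite (verts G \<times> verts G)"
    using assms(1) by (simp add: simple_graph_def)
qed

lemma strong_clique_cross_adj: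
  assumes "strong_clique G S" "independent_set G X" "independent_set G Y"
    and "e \<in> edges_between X Y S" "f \<in> edges_between X Y S"
  shows "cross_adj G e f \<or> cross_adj G f e"
proof -
  have ends: "fst e \<in> X" "snd e \<in> Y" "{fst e, snd e} \<in> S"
    "fst f \<in> X" "snd f \<in> Y" "{fst f, snd f} \<in> S"
    using assms(4,5) by (auto simp: edges_between_def)
  then have "\<not> adj G (fst e) (fst f)" "\<not> adj G (snd e) (snd f)"
    using assms(2,3) by (auto simp: independent_set_def)
  then show ?thesis
    using strong_clique_ends_adj[OF assms(1) ends(3,6)] by (simp add: cross_adj_def adj_commute)
qed

primrec zigzag :: "('a \<times> 'a) list \<Rightarrow> 'a list" where
  "zigzag [] = []"
| "zigzag (e # es) = snd e # fst e # zigzag es"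

lemma length_zigzag: "length (zigzag es) = 2 * length es"
  by (induction es) auto

lemma set_zigzag: "set (zigzag es) = fst ` set es \<union> snd ` set es"
  by (induction es) auto

lemma zigzag_append: "zigzag (es @ fs) = zigzag es @ zigzag fs"
  by (induction es) auto

lemma hd_zigzag: "es \<noteq> [] \<Longrightarrow> hd (zigzag es) = snd (hd es)"
  by (cases es) auto

lemma last_zigzag: "es \<noteq> [] \<Longrightarrow> last (zigzag es) = fst (last es)"
  by (induction es rule: rev_induct) (auto simp: zigzag_append)

lemma distinct_zigzag:
  assumes "distinct es" "matching (set es)" "fst ` set es \<inter> snd ` set es = {}"
  shows "distinct (zigzag es)"
  using assms
proof (induction es)
  case Nil
  then show ?case by simp
next
  case (Cons e es)
  have "matching (set es)"
    using Cons.prems(2) by (rule matching_subset) auto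
  moreover have "fst e \<notin> fst ` set es" "snd e \<notin> snd ` set es"
    using Cons.prems(1,2) by (auto simp: matching_def)
  ultimately show ?case
    using Cons by (auto simp: set_zigzag)
qed

lemma successively_zigzag:
  assumes "\<And>e. e \<in> set es \<Longrightarrow> cross_adj G e e" "successively (cross_adj G) es"
  shows "successively (adj G) (zigzag es)"
  using assms
  by (induction es rule: induct_list012) (auto simp: cross_adj_def adj_commute)

lemma zigzag_closes_to_cycle:
  assumes "simple_graph G" "es \<noteq> []" "distinct (zigzag es)" "successively (adj G) (zigzag es)"
    and "cross_adj G (last es) (hd es)"
  shows "contains_subgraph G (cycle_graph (2 * length es))"
proof -
  have "adj G (last (zigzag es)) (hd (zigzag es))"
    using assms(2,5) by (simp add: hd_zigzag last_zigzag cross_adj_def)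
  then have "contains_subgraph G (cycle_graph (length (zigzag es)))"
    using assms(1,3,4) by (intro contains_cycle_graphI)
  then show ?thesis
    by (simp add: length_zigzag)
qed

lemma zigzag_interior_closes_to_cycle:
  assumes "simple_graph G" "distinct (zigzag (e # es @ [f]))"
    and "successively (adj G) (zigzag (e # es @ [f]))" "cross_adj G e f"
  shows "contains_subgraph G (cycle_graph (2 * length es + 2))"
proof -
  let ?interior = "fst e # zigzag es @ [snd f]"
  have split: "zigzag (e # es @ [f]) = [snd e] @ ?interior @ [fst f]"
    by (simp add: zigzag_append)
  have "distinct ?interior"
    using assms(2) unfolding split by simp
  moreover have "successively (adj G) ?interior"
    using assms(3) unfolding split successively_append_iff by blast
  moreover have "adj G (last ?interior) (hd ?interior)"
    using assms(4) by (simp add: cross_adj_def adj_commute)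
  ultimately have "contains_subgraph G (cycle_graph (length ?interior))"
    using assms(1) by (intro contains_cycle_graphI)
  then show ?thesis
    by (simp add: length_zigzag)
qed

lemma semicomplete_matching_contains_cycle:
  assumes "simple_graph G" "k \<ge> 1" "card M = Suc k"
    and "matching M" "fst ` M \<inter> snd ` M = {}"
    and cross: "\<And>e f. e \<in> M \<Longrightarrow> f \<in> M \<Longrightarrow> cross_adj G e f \<or> cross_adj G f e"
  shows "contains_subgraph G (cycle_graph (2 * k)) \<or>
    contains_subgraph G (cycle_graph (2 * k + 2))"
proof -
  have "finite M"
    using assms(3) card.infinite by fastforce
  moreover have "totalp_on M (cross_adj G)"
    unfolding totalp_on_def using cross by blast
  ultimately obtain es where es: "distinct es" "set es = M" "successively (cross_adj G) es"
    using totalp_on_Hamiltonian_path by blast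
  have length: "length es = Suc k"
    using es(1,2) assms(3) distinct_card by metis
  then obtain e fs f where ends: "es = e # fs @ [f]"
    using assms(2) by (cases es; cases "tl es" rule: rev_cases) auto
  have distinct: "distinct (zigzag es)"
    using es assms(4,5) by (intro distinct_zigzag) auto
  have path: "successively (adj G) (zigzag es)"
    using es cross by (intro successively_zigzag) auto
  consider (forward) "cross_adj G e f" | (backward) "cross_adj G f e"
    using cross[of e f] es(2) by (auto simp: ends)
  then show ?thesis
  proof cases
    case forward
    moreover have "2 * length fs + 2 = 2 * k"
      using length by (simp add: ends)
    ultimately show ?thesis
      using zigzag_interior_closes_to_cycle[OF assms(1), of e fs f] distinct path
      unfolding ends by metis
  next
    case backward
    then have "contains_subgraph G (cycle_graph (2 * length es))"
      using distinct path by (intro zigzag_closes_to_cycle assms(1)) (auto simp: ends)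
    then show ?thesis
      by (simp add: length)
  qed
qed

section \<open>The bound\<close>

lemma degree_le_max_degree:
  assumes "simple_graph G"
  shows "degree G v \<le> max_degree G"
proof (cases "v \<in> verts G")
  case True
  then show ?thesis
    using assms by (auto simp: max_degree_def simple_graph_def intro: Max_ge)
next
  case False
  then have "{e \<in> edges G. v \<in> e} = {}"
    using assms by (auto simp: simple_graph_def)
  then show ?thesis
    by (metis card.empty degree_def le0)
qed

lemma finite_edges: "simple_graph G \<Longrightarrow> finite (edges G)"
  by (rule finite_subset[of _ "Pow (verts G)"]) (auto simp: simple_graph_def)

lemma card_edges_le_cover_mult_max_degree:
  assumes "simple_graph G" "S \<subseteq> edges G" "finite C" "\<And>e. e \<in> S \<Longrightarrow> e \<inter> C \<noteq> {}"
  shows "card S \<le> card C * max_degree G"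
proof -
  have "S \<subseteq> (\<Union>v\<in>C. {e \<in> edges G. v \<in> e})"
    using assms(2,4) by blast
  then have "card S \<le> card (\<Union>v\<in>C. {e \<in> edges G. v \<in> e})"
    using assms(3) finite_edges[OF assms(1)] by (intro card_mono) auto
  also have "\<dots> \<le> (\<Sum>v\<in>C. degree G v)"
    unfolding degree_def using assms(3) by (rule card_UN_le)
  also have "\<dots> \<le> card C * max_degree G"
    using sum_bounded_above[of C "degree G" "max_degree G"] degree_le_max_degree[OF assms(1)]
    by simp
  finally show ?thesis .
qed

lemma card_le_cover_number_mult_max_degree:
  assumes "simple_graph G" "S \<subseteq> edges G"
    and between: "\<And>e. e \<in> S \<Longrightarrow> \<exists>x\<in>X. \<exists>y\<in>Y. e = {x, y}"
  shows "card S \<le> cover_number (edges_between X Y S) * max_degree G"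
proof -
  obtain C D where cover: "vertex_cover C D (edges_between X Y S)"
    and card_cover: "card C + card D = cover_number (edges_between X Y S)"
    using finite_edges_between[OF assms(1,2)] by (rule minimum_vertex_cover)
  have "card S \<le> card (C \<union> D) * max_degree G"
  proof (rule card_edges_le_cover_mult_max_degree[OF assms(1,2)])
    show "finite (C \<union> D)"
      using cover by (simp add: vertex_cover_def)
    show "e \<inter> (C \<union> D) \<noteq> {}" if "e \<in> S" for e
      using between[OF that] that cover by (fastforce simp: edges_between_def vertex_cover_def)
  qed
  also have "\<dots> \<le> cover_number (edges_between X Y S) * max_degree G"
    using card_Un_le[of C D] by (simp add: card_cover mult_le_mono1)
  finally show ?thesis .
qed

lemma card_matching_in_strong_clique_le:
  assumes "simple_graph G" "strong_clique G S" "k \<ge> 1"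
    and XY: "independent_set G X" "independent_set G Y" "X \<inter> Y = {}"
    and no_cycle: "\<not> contains_subgraph G (cycle_graph (2 * k))"
      "\<not> contains_subgraph G (cycle_graph (2 * k + 2))"
    and M: "M \<subseteq> edges_between X Y S" "matching M"
  shows "card M \<le> k"
proof (rule ccontr)
  assume "\<not> card M \<le> k"
  then have "Suc k \<le> card M"
    by simp
  then obtain N where N: "N \<subseteq> M" "card N = Suc k"
    by (rule obtain_subset_with_card_n)
  have N_between: "N \<subseteq> edges_between X Y S"
    using N(1) M(1) by (rule subset_trans)
  then have "fst ` N \<subseteq> X" "snd ` N \<subseteq> Y"
    by (auto simp: edges_between_def)
  then have disjoint: "fst ` N \<inter> snd ` N = {}"
    using XY(3) by blast
  have "matching N"
    using M(2) N(1) by (rule matching_subset)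
  moreover have "cross_adj G e f \<or> cross_adj G f e" if "e \<in> N" "f \<in> N" for e f
    using that N_between by (intro strong_clique_cross_adj[OF assms(2) XY(1,2)]) auto
  ultimately show False
    using semicomplete_matching_contains_cycle[OF assms(1,3) N(2) _ disjoint] no_cycle by blast
qed

lemma strong_clique_card_le:
  assumes "simple_graph G" "strong_clique G S" "k \<ge> 1"
    and no_closed_5_walk: "\<And>x. \<not> (adj G ^^ 5) x x"
    and no_cycle: "\<not> contains_subgraph G (cycle_graph (2 * k))"
      "\<not> contains_subgraph G (cycle_graph (2 * k + 2))"
  shows "card S \<le> k * max_degree G"
proof -
  obtain X Y where XY: "independent_set G X" "independent_set G Y" "X \<inter> Y = {}"
    and between: "\<And>e. e \<in> S \<Longrightarrow> \<exists>x\<in>X. \<exists>y\<in>Y. e = {x, y}"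
    using strong_clique_bipartition[OF assms(1,2) no_closed_5_walk] by blast
  have "S \<subseteq> edges G"
    using assms(2) by (simp add: strong_clique_def)
  then have "finite (edges_between X Y S)"
    by (rule finite_edges_between[OF assms(1)])
  then obtain M where "M \<subseteq> edges_between X Y S" "matching M"
    and "card M = cover_number (edges_between X Y S)"
    using Koenig by blast
  then have "cover_number (edges_between X Y S) \<le> k"
    using card_matching_in_strong_clique_le[OF assms(1-3) XY no_cycle] by metis
  then have "cover_number (edges_between X Y S) * max_degree G \<le> k * max_degree G"
    by (rule mult_le_mono1)
  with card_le_cover_number_mult_max_degree[OF assms(1) \<open>S \<subseteq> edges G\<close> between]
  show ?thesis
    by (rule le_trans)
qed

theorem theorem10:
  fixes G :: "'a graph" and k \<Delta> :: nat
  assumes "k \<ge> 2"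
    and "simple_graph G"
    and "graph_free {cycle_graph 3, cycle_graph 5, cycle_graph (2 * k), cycle_graph (2 * k + 2)} G"
    and "max_degree G = \<Delta>"
  shows "strong_clique_number G \<le> max (k * \<Delta>) (2 * k * (k - 1))"
proof -
  have no_closed_5_walk: "\<not> (adj G ^^ 5) x x" for x
  proof
    assume "(adj G ^^ 5) x x"
    then obtain m where "odd m" "3 \<le> m" "m \<le> 5" "contains_subgraph G (cycle_graph m)"
      using closed_odd_walk_contains_odd_cycle[OF assms(2)] by (metis odd_numeral)
    moreover from this have "m = 3 \<or> m = 5"
      by presburger
    ultimately show False
      using assms(3) by (auto simp: graph_free_def)
  qed
  have "card S \<le> k * \<Delta>" if "strong_clique G S" for S
    using strong_clique_card_le[OF assms(2) that _ no_closed_5_walk] assms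
    by (simp add: graph_free_def)
  then have "strong_clique_number G \<le> k * \<Delta>"
    unfolding strong_clique_number_def using finite_strong_clique_cards[OF assms(2)]
    by (subst Max_le_iff) auto
  then show ?thesis
    by simp
qed

end
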